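(* Let $\widetilde{\mathsf{Verify}}$ be the verifier of the protocol $\widetilde{\Pi}$ defined in the context. Then $\widetilde{\Pi}$ satisfies $(2^{\lambda^c},\,|\mathcal{K}|\cdot2^{-\Omega(t\lambda)})$-soundness in the CROM: for any unbounded-time adversary $\mathcal{A}$ making at most $2^{\lambda^c}$ classical queries to a uniformly random $H:[t]\times\Sigma\to\{0,1\}^n$, $$\Pr_{H}\left[\widetilde{\mathsf{Verify}}^{H}(1^\lambda,\widetilde{\pi})=\top:\widetilde{\pi}\leftarrow\mathcal{A}^{H}(1^\lambda)\right]\le|\mathcal{K}|\cdot2^{-\Omega(t\lambda)}.$$
   Context: $\lambda$ is the security parameter and $t=t(\lambda)$ is a positive integer; the constant hidden in $\Omega(t\lambda)$ does not depend on $t$. Fix constants $0<c<c'<1$ and a family of codes $C=C_\lambda\subseteq\Sigma^n$ over $\Sigma=\mathbb{F}_q^m$, $\mathbb{F}_q$-linear, with $|\Sigma|=2^{\lambda^{\Theta(1)}}$, $n=\Theta(\lambda)$, $|C|\ge2^{n+\lambda}$, such that $C$ is $(\zeta,\ell,L)$-list recoverable with $\zeta=\Omega(1)$, $\ell=2^{\lambda^c}$, $L=2^{\tilde O(\lambda^{c'})}$: for all $S_i\subseteq\Sigma$ with $|S_i|\le\ell$ ($i\in[n]$), at most $L$ codewords $\mathbf{x}=(\mathbf{x}_1,\dots,\mathbf{x}_n)\in C$ satisfy $|\{i:\mathbf{x}_i\in S_i\}|\ge(1-\zeta)n$. For $G:\Sigma\to\{0,1\}^n$ with $i$-th output bit $G_i$,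 $\mathsf{Verify}^{G}(1^\lambda,\pi)$ parses $\pi=(\mathbf{x}_1,\dots,\mathbf{x}_n)\in\Sigma^n$ and outputs $\top$ iff $\pi\in C$ and $G_i(\mathbf{x}_i)=1$ for all $i\in[n]$. Let $H^{(j)}(x)=H(j\|x)$ for $j\in[t]$, and let $\{f_K:\Sigma\to\{0,1\}^n\}_{K\in\mathcal{K}}$ be a family of $2(\lambda n+1)$-wise independent hash functions with finite key set $\mathcal{K}$. Put $\widetilde{H}^{(j)}_K(x)=H^{(j)}(x)\oplus f_K(x)$. A proof is $\widetilde{\pi}=(K,\{\pi^{(j)}\}_{j\in[t]})$ with $K\in\mathcal{K}$, and $\widetilde{\mathsf{Verify}}^{H}(1^\lambda,\widetilde{\pi})$ outputs $\top$ iff $\mathsf{Verify}^{\widetilde{H}^{(j)}_K}(1^\lambda,\pi^{(j)})=\top$ for all $j\in[t]$. (The honest prover of $\widetilde{\Pi}$ plays no role in soundness.) *)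

theory Defs
  imports
    "HOL-Probability.Probability"
    "HOL-Algebra.Module"
    "HOL-Library.Landau_Symbols"
begin

text \<open>Vectors are extensional functions on an initial segment of the positive integers, so that
  spaces of vectors and spaces of oracles are plain \<^const>\<open>PiE\<close> sets. A bit is a \<^typ>\<open>bool\<close>,
  with \<^const>\<open>True\<close> for 1, and \<open>\<noteq>\<close> is exclusive or.\<close>

definition bitstrings :: "nat \<Rightarrow> (nat \<Rightarrow> bool) set" where
  "bitstrings n = {1..n} \<rightarrow>\<^sub>E UNIV"

definition xor_bits :: "nat \<Rightarrow> (nat \<Rightarrow> bool) \<Rightarrow> (nat \<Rightarrow> bool) \<Rightarrow> nat \<Rightarrow> bool" where
  "xor_bits n a b = (\<lambda>i\<in>{1..n}. a i \<noteq> b i)"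


section \<open>Codes over the alphabet of length-m vectors over a field\<close>

definition alphabet :: "('a, 'b) ring_scheme \<Rightarrow> nat \<Rightarrow> (nat \<Rightarrow> 'a) set" where
  "alphabet F m = {1..m} \<rightarrow>\<^sub>E carrier F"

text \<open>The F-vector space of words of length n over the alphabet. The record type
  \<^typ>\<open>('a, 'v) module\<close> extends rings, so the unused multiplicative fields have to be filled in;
  neither \<^const>\<open>module\<close> nor \<^const>\<open>submodule\<close> looks at them.\<close>

definition word_space ::
    "('a, 'b) ring_scheme \<Rightarrow> nat \<Rightarrow> nat \<Rightarrow> ('a, nat \<Rightarrow> nat \<Rightarrow> 'a) module" where
  "word_space F m n =
     \<lparr>carrier = {1..n} \<rightarrow>\<^sub>E alphabet F m,
      mult = undefined, one = undefined,
      zero = (\<lambda>i\<in>{1..n}. \<lambda>k\<in>{1..m}. \<zero>\<^bsub>F\<^esub>),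
      add = (\<lambda>x y. \<lambda>i\<in>{1..n}. \<lambda>k\<in>{1..m}. x i k \<oplus>\<^bsub>F\<^esub> y i k),
      smult = (\<lambda>a x. \<lambda>i\<in>{1..n}. \<lambda>k\<in>{1..m}. a \<otimes>\<^bsub>F\<^esub> x i k)\<rparr>"

lemma word_space_mem:
  "x \<in> carrier (word_space F m n) \<longleftrightarrow>
     x \<in> {1..n} \<rightarrow>\<^sub>E ({1..m} \<rightarrow>\<^sub>E carrier F)"
  by (simp add: word_space_def alphabet_def)

lemma word_space_eqI:
  assumes "x \<in> carrier (word_space F m n)" "y \<in> carrier (word_space F m n)"
    and "\<And>i k. i \<in> {1..n} \<Longrightarrow> k \<in> {1..m} \<Longrightarrow> x i k = y i k"
  shows "x = y"
proof (rule PiE_ext[OF assms(1,2)[unfolded word_space_mem]])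
  fix i assume i: "i \<in> {1..n}"
  have "x i \<in> {1..m} \<rightarrow>\<^sub>E carrier F" "y i \<in> {1..m} \<rightarrow>\<^sub>E carrier F"
    using assms(1,2) i unfolding word_space_mem by blast+
  then show "x i = y i"
    using assms(3)[OF i] by (rule PiE_ext)
qed

lemma word_space_module:
  assumes "Ring.field F"
  shows "Module.module F (word_space F m n)"
proof -
  interpret F: Ring.field F by fact
  let ?W = "word_space F m n"
  have app: "x i k \<in> carrier F"
    if "x \<in> carrier ?W" "i \<in> {1..n}" "k \<in> {1..m}" for x i k
    using that unfolding word_space_mem by blast
  have memI: "(\<lambda>i\<in>{1..n}. \<lambda>k\<in>{1..m}. g i k) \<in> carrier ?W"
    if "\<And>i k. i \<in> {1..n} \<Longrightarrow> k \<in> {1..m} \<Longrightarrow> g i k \<in> carrier F" for g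
    using that unfolding word_space_mem by auto
  have add: "x \<oplus>\<^bsub>?W\<^esub> y = (\<lambda>i\<in>{1..n}. \<lambda>k\<in>{1..m}. x i k \<oplus>\<^bsub>F\<^esub> y i k)" for x y
    by (simp add: word_space_def)
  have zero: "\<zero>\<^bsub>?W\<^esub> = (\<lambda>i\<in>{1..n}. \<lambda>k\<in>{1..m}. \<zero>\<^bsub>F\<^esub>)"
    by (simp add: word_space_def)
  have sm: "a \<odot>\<^bsub>?W\<^esub> x = (\<lambda>i\<in>{1..n}. \<lambda>k\<in>{1..m}. a \<otimes>\<^bsub>F\<^esub> x i k)" for a x
    by (simp add: word_space_def)
  have add_cl: "x \<oplus>\<^bsub>?W\<^esub> y \<in> carrier ?W"
    if "x \<in> carrier ?W" "y \<in> carrier ?W" for x y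
    unfolding add using that by (intro memI F.a_closed app)
  have zero_cl: "\<zero>\<^bsub>?W\<^esub> \<in> carrier ?W"
    unfolding zero by (intro memI F.zero_closed)
  have sm_cl: "a \<odot>\<^bsub>?W\<^esub> x \<in> carrier ?W"
    if "a \<in> carrier F" "x \<in> carrier ?W" for a x
    unfolding sm using that by (intro memI F.m_closed app[OF that(2)])
  have ab: "abelian_group ?W"
  proof (rule abelian_groupI)
    fix x assume x: "x \<in> carrier ?W"
    let ?y = "\<lambda>i\<in>{1..n}. \<lambda>k\<in>{1..m}. \<ominus>\<^bsub>F\<^esub> x i k"
    have y: "?y \<in> carrier ?W"
      using x by (intro memI F.a_inv_closed app)
    have "?y \<oplus>\<^bsub>?W\<^esub> x = \<zero>\<^bsub>?W\<^esub>"
      by (rule word_space_eqI[OF add_cl[OF y x] zero_cl])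
        (simp add: add zero F.l_neg app[OF x])
    then show "\<exists>y\<in>carrier ?W. y \<oplus>\<^bsub>?W\<^esub> x = \<zero>\<^bsub>?W\<^esub>"
      using y by blast
  qed (rule add_cl zero_cl | assumption | rule word_space_eqI[where F = F and m = m and n = n]
        | simp add: add zero F.a_ac app)+
  show ?thesis
    by (rule Module.moduleI[OF F.is_cring ab])
      (rule sm_cl add_cl F.a_closed F.m_closed F.one_closed | assumption
        | rule word_space_eqI[where F = F and m = m and n = n]
        | simp add: sm add F.l_distr F.r_distr F.m_assoc app)+
qed

definition list_recoverable ::
    "(nat \<Rightarrow> 's) set \<Rightarrow> 's set \<Rightarrow> nat \<Rightarrow> real \<Rightarrow> real \<Rightarrow> real \<Rightarrow> bool" where
  "list_recoverable C \<Sigma> n \<zeta> l L \<longleftrightarrow>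
     (\<forall>S. (\<forall>i\<in>{1..n}. S i \<subseteq> \<Sigma> \<and> real (card (S i)) \<le> l) \<longrightarrow>
        real (card {x \<in> C. (1 - \<zeta>) * real n \<le> real (card {i \<in> {1..n}. x i \<in> S i})}) \<le> L)"


section \<open>Hash families\<close>

text \<open>On any at most k points of the domain, the values under a uniformly random key are
  uniform and independent. (When the domain has at least k points, this is the same as asking it
  for exactly k distinct points.)\<close>

definition kwise_independent_hash ::
    "nat \<Rightarrow> 'k set \<Rightarrow> ('k \<Rightarrow> 's \<Rightarrow> 'r) \<Rightarrow> 's set \<Rightarrow> 'r set \<Rightarrow> bool" where
  "kwise_independent_hash k \<K> f D R \<longleftrightarrow>
     finite \<K> \<and> \<K> \<noteq> {} \<and> (\<forall>K\<in>\<K>. f K \<in> D \<rightarrow> R) \<and>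
     (\<forall>X\<subseteq>D. finite X \<and> card X \<le> k \<longrightarrow>
        map_pmf (\<lambda>K. restrict (f K) X) (pmf_of_set \<K>) = pmf_of_set (X \<rightarrow>\<^sub>E R))"


section \<open>Soundness in the classical random oracle model\<close>

text \<open>An unbounded-time adversary is an arbitrary interactive strategy: it outputs a value, or
  samples from an arbitrary discrete distribution and continues, or makes a classical oracle query
  and continues depending on the answer. There is no uniformity in the security parameter, so an
  adversary may be chosen separately for each value of it.\<close>

datatype ('q, 'r, 'o) adversary =
    Output 'o
  | Sample "nat pmf" "nat \<Rightarrow> ('q, 'r, 'o) adversary"
  | Query 'q "'r \<Rightarrow> ('q, 'r, 'o) adversary"

primrec run :: "('q \<Rightarrow> 'r) \<Rightarrow> ('q, 'r, 'o) adversary \<Rightarrow> 'o pmf" where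
  "run H (Output z) = return_pmf z"
| "run H (Sample p k) = bind_pmf p (\<lambda>s. run H (k s))"
| "run H (Query x k) = run H (k (H x))"

text \<open>With oracle H, every execution of the adversary makes at most b queries, all in D.\<close>

primrec queries_at_most ::
    "'q set \<Rightarrow> ('q \<Rightarrow> 'r) \<Rightarrow> ('q, 'r, 'o) adversary \<Rightarrow> nat \<Rightarrow> bool" where
  "queries_at_most D H (Output z) b \<longleftrightarrow> True"
| "queries_at_most D H (Sample p k) b \<longleftrightarrow> (\<forall>s\<in>set_pmf p. queries_at_most D H (k s) b)"
| "queries_at_most D H (Query x k) b \<longleftrightarrow>
     x \<in> D \<and> 0 < b \<and> queries_at_most D H (k (H x)) (b - 1)"

definition success_prob ::
    "'q set \<Rightarrow> 'r set \<Rightarrow> (('q \<Rightarrow> 'r) \<Rightarrow> 'o \<Rightarrow> bool) \<Rightarrow> ('q, 'r, 'o) adversary \<Rightarrow> real" where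
  "success_prob D R verify A =
     pmf (bind_pmf (pmf_of_set (D \<rightarrow>\<^sub>E R)) (\<lambda>H. map_pmf (verify H) (run H A))) True"

definition crom_sound ::
    "'q set \<Rightarrow> 'r set \<Rightarrow> (('q \<Rightarrow> 'r) \<Rightarrow> 'o \<Rightarrow> bool) \<Rightarrow> real \<Rightarrow> real \<Rightarrow> bool" where
  "crom_sound D R verify Q \<epsilon> \<longleftrightarrow>
     (\<forall>A. (\<forall>H \<in> D \<rightarrow>\<^sub>E R. queries_at_most D H A (nat \<lfloor>Q\<rfloor>)) \<longrightarrow>
        success_prob D R verify A \<le> \<epsilon>)"


section \<open>The verifiers\<close>

definition verify ::
    "'s set \<Rightarrow> nat \<Rightarrow> (nat \<Rightarrow> 's) set \<Rightarrow> ('s \<Rightarrow> nat \<Rightarrow> bool) \<Rightarrow> (nat \<Rightarrow> 's) \<Rightarrow> bool" where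
  "verify \<Sigma> n C G \<pi> \<longleftrightarrow>
     \<pi> \<in> {1..n} \<rightarrow>\<^sub>E \<Sigma> \<and> \<pi> \<in> C \<and> (\<forall>i\<in>{1..n}. G (\<pi> i) i)"

text \<open>The j-th of the t domain-separated oracles is the function mapping x to H (j, x).\<close>

definition masked_oracle ::
    "nat \<Rightarrow> ('k \<Rightarrow> 's \<Rightarrow> nat \<Rightarrow> bool) \<Rightarrow> (nat \<times> 's \<Rightarrow> nat \<Rightarrow> bool) \<Rightarrow>
     'k \<Rightarrow> nat \<Rightarrow> 's \<Rightarrow> nat \<Rightarrow> bool" where
  "masked_oracle n f H K j x = xor_bits n (H (j, x)) (f K x)"

definition verify_tilde ::
    "'s set \<Rightarrow> nat \<Rightarrow> (nat \<Rightarrow> 's) set \<Rightarrow> nat \<Rightarrow> 'k set \<Rightarrow> ('k \<Rightarrow> 's \<Rightarrow> nat \<Rightarrow> bool) \<Rightarrow>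
     (nat \<times> 's \<Rightarrow> nat \<Rightarrow> bool) \<Rightarrow> 'k \<times> (nat \<Rightarrow> nat \<Rightarrow> 's) \<Rightarrow> bool" where
  "verify_tilde \<Sigma> n C t \<K> f H = (\<lambda>(K, \<pi>).
     K \<in> \<K> \<and> (\<forall>j\<in>{1..t}. verify \<Sigma> n C (masked_oracle n f H K j) (\<pi> j)))"

end

(* A union bound over the keys reduces the claim to a fixed key K, for which f_K is just a fixed
   mask: acceptance asks the bits H (j, x_i) i to avoid prescribed values. Sample H lazily. By list
   recoverability the queries to one oracle can cover a (1 - zeta)-fraction of the coordinates of
   at most L codewords. Each of these still had more than zeta n undetermined bits just before the
   query by which it crossed that threshold, as has any output that never crosses it. Hence
   L + 1 times 2^(-zeta n) bounds the probability for one oracle. Adaptivity across the t oracles is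
   handled by a potential that is a product of t factors: every query changes only one factor, and
   does not increase it in expectation, so the bounds multiply. Finally log L = o(lambda). *)

theory Submission
  imports Defs "HOL-Real_Asymp.Real_Asymp"
begin

section \<open>Lazy sampling of a random oracle\<close>

definition answers :: "'r set \<Rightarrow> ('q \<rightharpoonup> 'r) \<Rightarrow> 'q \<Rightarrow> 'r set" where
  "answers R \<sigma> q = (case \<sigma> q of None \<Rightarrow> R | Some y \<Rightarrow> {y})"

text \<open>Conditioning a uniform oracle on recorded answers from \<open>R\<close> gives the
  uniform distribution on this set; since it is a product set, answers at unqueried points stay
  independent.\<close>

definition oracles :: "'q set \<Rightarrow> 'r set \<Rightarrow> ('q \<rightharpoonup> 'r) \<Rightarrow> ('q \<Rightarrow> 'r) set" where
  "oracles D R \<sigma> = PiE D (answers R \<sigma>)"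

lemma answers_simps [simp]:
  "\<sigma> q = None \<Longrightarrow> answers R \<sigma> q = R"
  "\<sigma> q = Some y \<Longrightarrow> answers R \<sigma> q = {y}"
  by (simp_all add: answers_def)

lemma answers_upd: "answers R (\<sigma>(x \<mapsto> y)) q = (if q = x then {y} else answers R \<sigma> q)"
  by (simp add: answers_def)

lemma oracles_empty [simp]: "oracles D R Map.empty = D \<rightarrow>\<^sub>E R"
  unfolding oracles_def by (rule PiE_cong) simp

text \<open>Serves for the adversary's own coins, whose discrete distribution may have infinite
  support.\<close>

lemma pmf_bind_le_const:
  assumes "\<And>s. s \<in> set_pmf p \<Longrightarrow> pmf (f s) i \<le> c"
  shows "pmf (bind_pmf p f) i \<le> c"
  unfolding pmf_bind
  by (rule measure_pmf.integral_le_const)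
    (auto intro!: AE_pmfI assms measure_pmf.integrable_const_bound[where B = 1]
      simp: pmf_nonneg pmf_le_1)

locale finite_oracles =
  fixes D :: "'q set" and R :: "'r set"
  assumes finite_D [simp]: "finite D" and finite_R [simp]: "finite R" and R_nonempty [simp]: "R \<noteq> {}"
begin

lemma finite_answers [simp]: "finite (answers R \<sigma> q)"
  and answers_nonempty [simp]: "answers R \<sigma> q \<noteq> {}"
  by (simp_all add: answers_def split: option.split)

lemma card_answers_pos: "card (answers R \<sigma> q) > 0"
  by (simp add: card_gt_0_iff)

lemma finite_oracles [simp]: "finite (oracles D R \<sigma>)"
  and oracles_nonempty [simp]: "oracles D R \<sigma> \<noteq> {}"
  by (simp_all add: oracles_def finite_PiE PiE_eq_empty_iff)

lemma oracles_split:
  assumes "x \<in> D" "\<sigma> x = None"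
  shows "oracles D R \<sigma> = (\<Union>y\<in>R. oracles D R (\<sigma>(x \<mapsto> y)))"
proof (intro equalityI subsetI)
  fix H assume H: "H \<in> oracles D R \<sigma>"
  then have "H x \<in> R" using assms PiE_mem[of H D "answers R \<sigma>" x] by (simp add: oracles_def)
  moreover have "H \<in> oracles D R (\<sigma>(x \<mapsto> H x))"
    using H by (auto simp: oracles_def PiE_iff answers_upd)
  ultimately show "H \<in> (\<Union>y\<in>R. oracles D R (\<sigma>(x \<mapsto> y)))" by (rule UN_I)
next
  fix H assume "H \<in> (\<Union>y\<in>R. oracles D R (\<sigma>(x \<mapsto> y)))"
  then obtain y where "y \<in> R" and H: "H \<in> oracles D R (\<sigma>(x \<mapsto> y))" by (rule UN_E)
  have "H q \<in> answers R \<sigma> q" if "q \<in> D" for q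
    using that H \<open>y \<in> R\<close> assms(2)
    by (cases "q = x") (force simp: oracles_def PiE_iff answers_upd)+
  then show "H \<in> oracles D R \<sigma>"
    using H by (simp add: oracles_def PiE_iff)
qed

lemma oracles_upd_apply:
  assumes "x \<in> D" "H \<in> oracles D R (\<sigma>(x \<mapsto> y))"
  shows "H x = y"
  using assms PiE_mem[of H D "answers R (\<sigma>(x \<mapsto> y))" x] by (simp add: oracles_def answers_upd)

text \<open>Lazy sampling: the sets for different answers \<open>y\<close> are disjoint and of equal
  size, so a uniform oracle arises by drawing the answer at \<open>x\<close> first and the rest
  afterwards.\<close>

lemma pmf_of_oracles_split:
  assumes "x \<in> D" "\<sigma> x = None"
  shows "pmf_of_set (oracles D R \<sigma>) =
    bind_pmf (pmf_of_set R) (\<lambda>y. pmf_of_set (oracles D R (\<sigma>(x \<mapsto> y))))"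
proof -
  have card: "card (oracles D R (\<sigma>(x \<mapsto> y))) = (\<Prod>q\<in>D. if q = x then 1 else card (answers R \<sigma> q))"
    for y
    by (auto simp: oracles_def card_PiE answers_upd intro!: prod.cong)
  have disj: "disjoint_family_on (\<lambda>y. oracles D R (\<sigma>(x \<mapsto> y))) R"
    unfolding disjoint_family_on_def
    using oracles_upd_apply[OF assms(1)] by blast
  show ?thesis
    unfolding oracles_split[of x \<sigma>, OF assms]
    by (rule pmf_of_set_UN[where n = "\<Prod>q\<in>D. if q = x then 1 else card (answers R \<sigma> q)"])
      (use card disj in auto)
qed

text \<open>A potential that is a supermartingale under fresh queries and dominates the success
  probability of every fixed output bounds the success probability of every adversary.\<close>

lemma success_le_potential:
  fixes \<Phi> :: "('q \<rightharpoonup> 'r) \<Rightarrow> real" and A :: "('q, 'r, 'o) adversary"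
  assumes step: "\<And>\<sigma> x. dom \<sigma> \<subseteq> D \<Longrightarrow> card (dom \<sigma>) < Q \<Longrightarrow> x \<in> D \<Longrightarrow> \<sigma> x = None \<Longrightarrow>
      (\<Sum>y\<in>R. \<Phi> (\<sigma>(x \<mapsto> y))) / card R \<le> \<Phi> \<sigma>"
    and final: "\<And>\<sigma> z. dom \<sigma> \<subseteq> D \<Longrightarrow> card (dom \<sigma>) \<le> Q \<Longrightarrow>
      card {H \<in> oracles D R \<sigma>. V H z} / card (oracles D R \<sigma>) \<le> \<Phi> \<sigma>"
    and "\<And>H. H \<in> oracles D R \<sigma> \<Longrightarrow> queries_at_most D H A b"
    and "dom \<sigma> \<subseteq> D" "card (dom \<sigma>) + b \<le> Q"
  shows "pmf (bind_pmf (pmf_of_set (oracles D R \<sigma>)) (\<lambda>H. map_pmf (V H) (run H A))) True \<le> \<Phi> \<sigma>"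
  using assms(3-)
proof (induction A arbitrary: \<sigma> b)
  case (Output z)
  have "pmf (bind_pmf (pmf_of_set (oracles D R \<sigma>)) (\<lambda>H. map_pmf (V H) (run H (Output z)))) True
    = pmf (map_pmf (\<lambda>H. V H z) (pmf_of_set (oracles D R \<sigma>))) True"
    by (simp add: map_pmf_def bind_return_pmf)
  also have "\<dots> = card (oracles D R \<sigma> \<inter> (\<lambda>H. V H z) -` {True}) / card (oracles D R \<sigma>)"
    by (simp add: pmf_map measure_pmf_of_set)
  also have "oracles D R \<sigma> \<inter> (\<lambda>H. V H z) -` {True} = {H \<in> oracles D R \<sigma>. V H z}" by auto
  finally show ?case using final[of \<sigma> z] Output by simp
next
  case (Sample p k)
  \<comment> \<open>The coins are independent of the oracle and can be drawn first; each outcome is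
    then a case of the induction hypothesis.\<close>
  have "pmf (bind_pmf p (\<lambda>s. bind_pmf (pmf_of_set (oracles D R \<sigma>))
      (\<lambda>H. map_pmf (V H) (run H (k s))))) True \<le> \<Phi> \<sigma>"
    using Sample.prems by (intro pmf_bind_le_const Sample.IH[where b = b]) auto
  then show ?case
    by (simp add: map_bind_pmf bind_commute_pmf[of p])
next
  case (Query x k)
  \<comment> \<open>The query bound is assumed for consistent oracles only; since one exists, it
    yields \<open>x \<in> D\<close> and a positive remaining budget.\<close>
  obtain H0 where H0: "H0 \<in> oracles D R \<sigma>" using oracles_nonempty by blast
  then have x: "x \<in> D" and b: "0 < b" using Query.prems(1) by auto
  show ?case
  proof (cases "\<sigma> x")
    case (Some y)
    \<comment> \<open>A repeated query has a forced answer: \<open>\<sigma>\<close> and hence the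
      potential stay as they are.\<close>
    have Hx: "H x = y" if "H \<in> oracles D R \<sigma>" for H
      using that Some x PiE_mem[of H D "answers R \<sigma>" x] by (simp add: oracles_def)
    have "pmf (bind_pmf (pmf_of_set (oracles D R \<sigma>)) (\<lambda>H. map_pmf (V H) (run H (k y)))) True \<le> \<Phi> \<sigma>"
    proof (rule Query.IH[where b = "b - 1"])
      fix H assume "H \<in> oracles D R \<sigma>"
      then show "queries_at_most D H (k y) (b - 1)" using Query.prems(1)[of H] Hx by simp
    qed (use Query.prems(2,3) in auto)
    also have "bind_pmf (pmf_of_set (oracles D R \<sigma>)) (\<lambda>H. map_pmf (V H) (run H (k y))) =
      bind_pmf (pmf_of_set (oracles D R \<sigma>)) (\<lambda>H. map_pmf (V H) (run H (Query x k)))"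
      by (rule bind_pmf_cong) (simp_all add: Hx)
    finally show ?thesis .
  next
    case None
    have fin: "finite (dom \<sigma>)" by (rule finite_subset[OF Query.prems(2) finite_D])
    have "card (dom \<sigma>) < Q" using Query.prems b by simp
    have IH: "pmf (bind_pmf (pmf_of_set (oracles D R (\<sigma>(x \<mapsto> y))))
        (\<lambda>H. map_pmf (V H) (run H (k y)))) True \<le> \<Phi> (\<sigma>(x \<mapsto> y))" if "y \<in> R" for y
    proof (rule Query.IH[where b = "b - 1"])
      fix H assume H: "H \<in> oracles D R (\<sigma>(x \<mapsto> y))"
      then have "H \<in> oracles D R \<sigma>" using that unfolding oracles_split[of x \<sigma>, OF x None] by blast
      then show "queries_at_most D H (k y) (b - 1)"
        using Query.prems(1)[of H] oracles_upd_apply[OF x H] by simp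
    next
      have "card (dom (\<sigma>(x \<mapsto> y))) = card (dom \<sigma>) + 1"
        using None fin by (simp add: card_insert_if domIff)
      then show "card (dom (\<sigma>(x \<mapsto> y))) + (b - 1) \<le> Q" using b Query.prems(3) by linarith
    qed (use Query.prems(2) x in \<open>auto simp: subset_iff domIff\<close>)
    \<comment> \<open>A fresh query averages the induction hypothesis over a uniform answer, and
      \<open>step\<close> bounds this average.\<close>
    have "bind_pmf (pmf_of_set (oracles D R \<sigma>)) (\<lambda>H. map_pmf (V H) (run H (Query x k))) =
      bind_pmf (pmf_of_set R) (\<lambda>y. bind_pmf (pmf_of_set (oracles D R (\<sigma>(x \<mapsto> y))))
        (\<lambda>H. map_pmf (V H) (run H (k y))))"
      unfolding pmf_of_oracles_split[of x \<sigma>, OF x None] bind_assoc_pmf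
    proof (intro bind_pmf_cong refl)
      fix y H assume "H \<in> set_pmf (pmf_of_set (oracles D R (\<sigma>(x \<mapsto> y))))"
      then have "H x = y" using oracles_upd_apply[OF x, of H \<sigma> y] by simp
      then show "map_pmf (V H) (run H (Query x k)) = map_pmf (V H) (run H (k y))" by simp
    qed
    then have "pmf (bind_pmf (pmf_of_set (oracles D R \<sigma>))
        (\<lambda>H. map_pmf (V H) (run H (Query x k)))) True =
      (\<Sum>y\<in>R. pmf (bind_pmf (pmf_of_set (oracles D R (\<sigma>(x \<mapsto> y))))
        (\<lambda>H. map_pmf (V H) (run H (k y)))) True) / card R"
      by (simp add: pmf_bind_pmf_of_set)
    also have "\<dots> \<le> (\<Sum>y\<in>R. \<Phi> (\<sigma>(x \<mapsto> y))) / card R"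
      by (intro divide_right_mono sum_mono IH) auto
    also have "\<dots> \<le> \<Phi> \<sigma>"
      by (rule step[OF Query.prems(2) \<open>card (dom \<sigma>) < Q\<close> x None])
    finally show ?thesis .
  qed
qed

end

text \<open>Makes acceptance by different verifiers events in one space, that of pairs of an oracle
  and an output, where a union bound applies even though the output depends on the oracle.\<close>

lemma success_prob_eq_measure:
  "success_prob D R V A = measure (measure_pmf (bind_pmf (pmf_of_set (D \<rightarrow>\<^sub>E R))
     (\<lambda>H. map_pmf (Pair H) (run H A)))) {(H, z). V H z}"
proof -
  have "bind_pmf (pmf_of_set (D \<rightarrow>\<^sub>E R)) (\<lambda>H. map_pmf (V H) (run H A)) =
    map_pmf (\<lambda>(H, z). V H z) (bind_pmf (pmf_of_set (D \<rightarrow>\<^sub>E R)) (\<lambda>H. map_pmf (Pair H) (run H A)))"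
    by (simp add: map_bind_pmf pmf.map_comp o_def)
  moreover have "(\<lambda>(H, z). V H z) -` {True} = {(H, z). V H z}" by auto
  ultimately show ?thesis
    unfolding success_prob_def by (simp add: pmf_map)
qed

lemma success_prob_union_bound:
  assumes "finite I" and V: "\<And>H z. V H z \<Longrightarrow> \<exists>i\<in>I. W i H z"
  shows "success_prob D R V A \<le> (\<Sum>i\<in>I. success_prob D R (W i) A)"
proof -
  let ?M = "measure_pmf (bind_pmf (pmf_of_set (D \<rightarrow>\<^sub>E R)) (\<lambda>H. map_pmf (Pair H) (run H A)))"
  have "measure ?M {(H, z). V H z} \<le> measure ?M (\<Union>i\<in>I. {(H, z). W i H z})"
    using V by (intro measure_pmf.finite_measure_mono) auto
  also have "\<dots> \<le> (\<Sum>i\<in>I. measure ?M {(H, z). W i H z})"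
    by (rule measure_UNION_le) (simp_all add: assms)
  finally show ?thesis by (simp add: success_prob_eq_measure)
qed


section \<open>The potential of a fixed key\<close>

declare One_nat_def [simp del]

section \<open>Counting bit strings and coordinates\<close>

lemma card_bitstrings: "card (bitstrings n) = 2 ^ n"
  by (simp add: bitstrings_def card_PiE)

lemma finite_bitstrings [simp]: "finite (bitstrings n)"
  and bitstrings_nonempty [simp]: "bitstrings n \<noteq> {}"
  by (simp_all add: bitstrings_def finite_PiE PiE_eq_empty_iff)

lemma card_bitstrings_constrained:
  assumes "I \<subseteq> {1..n}"
  shows "real (card {y \<in> bitstrings n. \<forall>i\<in>I. y i \<noteq> b i}) / real (card (bitstrings n)) = (1/2) ^ card I"
proof -
  have "{y \<in> bitstrings n. \<forall>i\<in>I. y i \<noteq> b i} = PiE {1..n} (\<lambda>i. if i \<in> I then {\<not> b i} else UNIV)"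
  proof (intro Set.set_eqI, unfold mem_Collect_eq)
    fix y :: "nat \<Rightarrow> bool"
    have "(\<forall>i\<in>{1..n}. y i \<in> (if i \<in> I then {\<not> b i} else UNIV)) \<longleftrightarrow> (\<forall>i\<in>I. y i \<noteq> b i)"
      using assms by auto
    then show "y \<in> bitstrings n \<and> (\<forall>i\<in>I. y i \<noteq> b i) \<longleftrightarrow>
        y \<in> PiE {1..n} (\<lambda>i. if i \<in> I then {\<not> b i} else UNIV)"
      unfolding bitstrings_def PiE_iff by blast
  qed
  then have "card {y \<in> bitstrings n. \<forall>i\<in>I. y i \<noteq> b i} = (\<Prod>i\<in>{1..n}. if i \<in> I then 1 else 2)"
    by (auto simp: card_PiE intro!: prod.cong)
  also have "\<dots> = 2 ^ card ({1..n} - I)"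
    by (simp add: prod.If_cases Diff_eq)
  finally have "card {y \<in> bitstrings n. \<forall>i\<in>I. y i \<noteq> b i} = 2 ^ (n - card I)"
    using assms by (simp add: card_Diff_subset finite_subset)
  moreover have "(2::real) ^ n = 2 ^ (n - card I) * 2 ^ card I"
    using card_mono[OF _ assms] by (simp flip: power_add)
  ultimately show ?thesis
    by (simp add: card_bitstrings power_one_over del: power_diff)
qed

text \<open>Used to merge a product over symbols of powers of 1/2 into one power whose exponent
  counts coordinates.\<close>

lemma sum_card_fibres:
  assumes "finite I" "finite U"
  shows "(\<Sum>x\<in>U. card {i\<in>I. w i = x}) = card {i\<in>I. w i \<in> U}"
proof -
  have "card (\<Union>x\<in>U. {i\<in>I. w i = x}) = (\<Sum>x\<in>U. card {i\<in>I. w i = x})"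
    using assms by (intro card_UN_disjoint) auto
  moreover have "(\<Union>x\<in>U. {i\<in>I. w i = x}) = {i\<in>I. w i \<in> U}" by auto
  ultimately show ?thesis by simp
qed

text \<open>The game for one key, whose hash function is the fixed \<open>mask\<close>. One set
  \<open>S\<close> serves at every coordinate, because the answer at a symbol reveals the bits for
  all coordinates at which it may stand.\<close>

locale code_game =
  fixes \<Sigma> :: "'s set" and n t L Q :: nat and C :: "(nat \<Rightarrow> 's) set"
    and mask :: "'s \<Rightarrow> nat \<Rightarrow> bool" and \<zeta> :: real
  assumes finite_alphabet [simp]: "finite \<Sigma>"
    and code_subset: "C \<subseteq> {1..n} \<rightarrow>\<^sub>E \<Sigma>"
    and card_list_le: "\<And>S. S \<subseteq> \<Sigma> \<Longrightarrow> card S \<le> Q \<Longrightarrow>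
      card {w \<in> C. (1 - \<zeta>) * real n \<le> real (card {i \<in> {1..n}. w i \<in> S})} \<le> L"
begin

sublocale finite_oracles "{1..t} \<times> \<Sigma>" "bitstrings n"
  by standard simp_all

lemma finite_code [simp]: "finite C"
  by (rule finite_subset[OF code_subset]) (simp add: finite_PiE)

text \<open>A masked bit is 1 exactly if the oracle bit differs from the mask. A symbol may stand at
  several coordinates of \<open>w\<close>, so one answer can be subject to several such
  conditions.\<close>

definition passes :: "(nat \<Rightarrow> 's) \<Rightarrow> 's \<Rightarrow> (nat \<Rightarrow> bool) \<Rightarrow> bool" where
  "passes w x y \<longleftrightarrow> (\<forall>i\<in>{1..n}. w i = x \<longrightarrow> y i \<noteq> mask x i)"

text \<open>Conditional on the answers recorded in \<open>\<sigma>\<close>, \<open>weight \<sigma> j w\<close> is the probability that the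
  word \<open>w\<close> is accepted by the \<open>j\<close>-th oracle; the answers at distinct points are independent.\<close>

definition pass_prob :: "(nat \<times> 's \<rightharpoonup> nat \<Rightarrow> bool) \<Rightarrow> nat \<Rightarrow> (nat \<Rightarrow> 's) \<Rightarrow> 's \<Rightarrow> real" where
  "pass_prob \<sigma> j w x =
     card {y \<in> answers (bitstrings n) \<sigma> (j, x). passes w x y} /
     card (answers (bitstrings n) \<sigma> (j, x))"

definition weight :: "(nat \<times> 's \<rightharpoonup> nat \<Rightarrow> bool) \<Rightarrow> nat \<Rightarrow> (nat \<Rightarrow> 's) \<Rightarrow> real" where
  "weight \<sigma> j w = (\<Prod>x\<in>\<Sigma>. pass_prob \<sigma> j w x)"

definition queried :: "(nat \<times> 's \<rightharpoonup> nat \<Rightarrow> bool) \<Rightarrow> nat \<Rightarrow> 's set" where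
  "queried \<sigma> j = {x \<in> \<Sigma>. \<sigma> (j, x) \<noteq> None}"

definition listed :: "(nat \<times> 's \<rightharpoonup> nat \<Rightarrow> bool) \<Rightarrow> nat \<Rightarrow> (nat \<Rightarrow> 's) set" where
  "listed \<sigma> j = {w \<in> C. (1 - \<zeta>) * real n \<le> real (card {i \<in> {1..n}. w i \<in> queried \<sigma> j})}"

definition \<theta> :: real where
  "\<theta> = 2 powr (- \<zeta> * real n)"

text \<open>A codeword that is about to become listed still has more than \<open>\<zeta> n\<close> unqueried
  coordinates, hence weight at most \<open>\<theta>\<close>. The first summand is a budget of \<open>\<theta>\<close> for each of the at
  most \<open>L\<close> codewords that may ever become listed, and \<open>\<theta>\<close> more for an unlisted final output.\<close>

definition potential :: "(nat \<times> 's \<rightharpoonup> nat \<Rightarrow> bool) \<Rightarrow> nat \<Rightarrow> real" where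
  "potential \<sigma> j = (real L + 1 - card (listed \<sigma> j)) * \<theta> + (\<Sum>w\<in>listed \<sigma> j. weight \<sigma> j w)"

section \<open>The weight of a codeword: upper bounds, and its average under a query\<close>

lemma \<theta>_nonneg [simp]: "0 \<le> \<theta>"
  by (simp add: \<theta>_def)

lemma pass_prob_nonneg [simp]: "0 \<le> pass_prob \<sigma> j w x"
  by (simp add: pass_prob_def)

lemma pass_prob_le_1 [simp]: "pass_prob \<sigma> j w x \<le> 1"
  using card_answers_pos[of \<sigma> "(j, x)"]
  by (auto simp: pass_prob_def divide_le_eq_1 intro!: card_mono)

lemma weight_nonneg [simp]: "0 \<le> weight \<sigma> j w"
  by (simp add: weight_def prod_nonneg)

lemma pass_prob_unqueried:
  assumes "\<sigma> (j, x) = None"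
  shows "pass_prob \<sigma> j w x = (1/2) ^ card {i\<in>{1..n}. w i = x}"
proof -
  have "{y \<in> bitstrings n. passes w x y} = {y \<in> bitstrings n. \<forall>i\<in>{i\<in>{1..n}. w i = x}. y i \<noteq> mask x i}"
    by (auto simp: passes_def)
  moreover have "{i\<in>{1..n}. w i = x} \<subseteq> {1..n}" by auto
  ultimately show ?thesis
    unfolding pass_prob_def answers_simps(1)[of \<sigma>, OF assms] by (simp only: card_bitstrings_constrained)
qed

text \<open>Factors of queried symbols are at most 1, while an unqueried symbol contributes 1/2 for
  each coordinate at which it stands.\<close>

lemma weight_le_unqueried:
  "weight \<sigma> j w \<le> (1/2) ^ card {i\<in>{1..n}. w i \<in> \<Sigma> - queried \<sigma> j}"
proof -
  have "weight \<sigma> j w \<le> (\<Prod>x\<in>\<Sigma>. if x \<in> queried \<sigma> j then 1 else (1/2) ^ card {i\<in>{1..n}. w i = x})"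
    unfolding weight_def
    by (intro prod_mono) (auto simp: queried_def pass_prob_unqueried)
  also have "\<dots> = (\<Prod>x\<in>\<Sigma> - queried \<sigma> j. (1/2) ^ card {i\<in>{1..n}. w i = x})"
    by (rule prod.mono_neutral_cong_right) auto
  also have "\<dots> = (1/2) ^ card {i\<in>{1..n}. w i \<in> \<Sigma> - queried \<sigma> j}"
    by (subst sum_card_fibres[symmetric]) (auto simp: power_sum)
  finally show ?thesis .
qed

text \<open>Missing the threshold of the list means that more than \<open>\<zeta> * real n\<close>
  coordinates carry unqueried symbols, at a cost of 1/2 each.\<close>

lemma weight_unlisted:
  assumes "w \<in> C" "w \<notin> listed \<sigma> j"
  shows "weight \<sigma> j w \<le> \<theta>"
proof -
  let ?q = "card {i\<in>{1..n}. w i \<in> queried \<sigma> j}" and ?u = "card {i\<in>{1..n}. w i \<in> \<Sigma> - queried \<sigma> j}"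
  \<comment> \<open>As the symbols of a codeword lie in \<open>\<Sigma>\<close>, the coordinates
    split into queried and unqueried ones.\<close>
  have "{1..n} = {i\<in>{1..n}. w i \<in> queried \<sigma> j} \<union> {i\<in>{1..n}. w i \<in> \<Sigma> - queried \<sigma> j}"
    using assms(1) code_subset by fastforce
  then have "card {1..n} = card ({i\<in>{1..n}. w i \<in> queried \<sigma> j} \<union> {i\<in>{1..n}. w i \<in> \<Sigma> - queried \<sigma> j})"
    by (rule arg_cong)
  also have "\<dots> = ?q + ?u" by (rule card_Un_disjoint) auto
  finally have "real n = real ?q + real ?u" by simp
  then have "\<zeta> * real n \<le> real ?u"
    using assms by (simp add: listed_def algebra_simps)
  then have "2 powr (- real ?u) \<le> \<theta>"
    by (simp add: \<theta>_def)
  moreover have "2 powr (- real ?u) = (1/2) ^ ?u"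
    by (simp only: powr_minus powr_realpow zero_less_numeral power_one_over inverse_eq_divide)
  ultimately show ?thesis
    using weight_le_unqueried[of \<sigma> j w] by linarith
qed

text \<open>A conditional probability is a martingale: the fresh answer turns the factor at
  \<open>x\<close> into a 0-1 indicator whose mean is the old factor, and the other factors
  stay.\<close>

lemma weight_step:
  assumes "x \<in> \<Sigma>" "\<sigma> (j, x) = None"
  shows "(\<Sum>y\<in>bitstrings n. weight (\<sigma>((j, x) \<mapsto> y)) j w) / card (bitstrings n) = weight \<sigma> j w"
proof -
  let ?r = "\<Prod>x'\<in>\<Sigma> - {x}. pass_prob \<sigma> j w x'"
  have upd: "weight (\<sigma>((j, x) \<mapsto> y)) j w = (if passes w x y then 1 else 0) * ?r" for y
  proof -
    have "weight (\<sigma>((j, x) \<mapsto> y)) j w = pass_prob (\<sigma>((j, x) \<mapsto> y)) j w x *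
        (\<Prod>x'\<in>\<Sigma> - {x}. pass_prob (\<sigma>((j, x) \<mapsto> y)) j w x')"
      unfolding weight_def using assms by (intro prod.remove) auto
    moreover have "(\<Prod>x'\<in>\<Sigma> - {x}. pass_prob (\<sigma>((j, x) \<mapsto> y)) j w x') = ?r"
      by (rule prod.cong) (auto simp: pass_prob_def answers_upd)
    moreover have "{y' \<in> {y}. passes w x y'} = (if passes w x y then {y} else {})" by auto
    ultimately show ?thesis by (simp add: pass_prob_def)
  qed
  have "(\<Sum>y\<in>bitstrings n. weight (\<sigma>((j, x) \<mapsto> y)) j w) = card {y\<in>bitstrings n. passes w x y} * ?r"
    unfolding upd by (simp add: sum_distrib_right[symmetric] sum.If_cases Int_def)
  moreover have "weight \<sigma> j w = pass_prob \<sigma> j w x * ?r"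
    unfolding weight_def using assms by (intro prod.remove) auto
  ultimately show ?thesis using assms by (simp add: pass_prob_def)
qed

section \<open>The list and the potential under queries\<close>

lemma finite_listed [simp]: "finite (listed \<sigma> j)"
  by (simp add: listed_def)

text \<open>Listing depends on which points were queried and not on their answers, so the list after
  a query is known before the answer is.\<close>

lemma listed_upd: "listed (\<sigma>((j, x) \<mapsto> y)) j = listed (\<sigma>((j, x) \<mapsto> y')) j"
  by (simp add: listed_def queried_def)

lemma listed_upd_mono: "listed \<sigma> j \<subseteq> listed (\<sigma>((j, x) \<mapsto> y)) j"
proof -
  have "card {i\<in>{1..n}. w i \<in> queried \<sigma> j} \<le> card {i\<in>{1..n}. w i \<in> queried (\<sigma>((j, x) \<mapsto> y)) j}" for w
    by (rule card_mono) (auto simp: queried_def)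
  then show ?thesis
    by (fastforce simp: listed_def intro: order_trans)
qed

text \<open>The queries to one oracle inject into all recorded queries, so the overall budget
  \<open>Q\<close> bounds the set handed to list recovery.\<close>

lemma card_listed_le:
  assumes "dom \<sigma> \<subseteq> {1..t} \<times> \<Sigma>" "card (dom \<sigma>) \<le> Q"
  shows "card (listed \<sigma> j) \<le> L"
proof -
  have fin: "finite (dom \<sigma>)" by (rule finite_subset[OF assms(1)]) simp
  have "Pair j ` queried \<sigma> j \<subseteq> dom \<sigma>" by (auto simp: queried_def)
  then have "card (Pair j ` queried \<sigma> j) \<le> card (dom \<sigma>)" using fin by (rule card_mono[rotated])
  then have "card (queried \<sigma> j) \<le> Q"
    using assms(2) by (simp add: card_image inj_on_def)
  then show ?thesis
    unfolding listed_def by (intro card_list_le) (auto simp: queried_def)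
qed

lemma potential_nonneg:
  assumes "dom \<sigma> \<subseteq> {1..t} \<times> \<Sigma>" "card (dom \<sigma>) \<le> Q"
  shows "0 \<le> potential \<sigma> j"
  using card_listed_le[OF assms, of j] by (simp add: potential_def sum_nonneg)

lemma potential_upd_other:
  assumes "j' \<noteq> j"
  shows "potential (\<sigma>((j, x) \<mapsto> y)) j' = potential \<sigma> j'"
  using assms by (simp add: potential_def weight_def listed_def queried_def pass_prob_def answers_upd)

text \<open>Words already listed contribute martingales. A newly listed word trades its budget
  \<open>\<theta>\<close> for its weight, which on average equals its weight before the query, when
  it was still unlisted and weighed at most \<open>\<theta>\<close>.\<close>

lemma potential_step:
  assumes "x \<in> \<Sigma>" "\<sigma> (j, x) = None"
  shows "(\<Sum>y\<in>bitstrings n. potential (\<sigma>((j, x) \<mapsto> y)) j) / card (bitstrings n) \<le> potential \<sigma> j"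
proof -
  let ?R = "bitstrings n"
  \<comment> \<open>The answer \<open>undefined\<close> is a placeholder: every answer gives the
    same list.\<close>
  define E where "E = listed (\<sigma>((j, x) \<mapsto> undefined)) j"
  have E: "listed (\<sigma>((j, x) \<mapsto> y)) j = E" for y
    unfolding E_def by (rule listed_upd)
  have sub: "listed \<sigma> j \<subseteq> E" unfolding E_def by (rule listed_upd_mono)
  have finE: "finite E" by (simp add: E_def)
  have "(\<Sum>y\<in>?R. potential (\<sigma>((j, x) \<mapsto> y)) j) / card ?R =
    (card ?R * ((real L + 1 - card E) * \<theta>) + (\<Sum>y\<in>?R. \<Sum>w\<in>E. weight (\<sigma>((j, x) \<mapsto> y)) j w)) / card ?R"
    by (simp add: potential_def E sum.distrib)
  also have "\<dots> = (real L + 1 - card E) * \<theta> + (\<Sum>w\<in>E. (\<Sum>y\<in>?R. weight (\<sigma>((j, x) \<mapsto> y)) j w) / card ?R)"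
    by (subst sum.swap) (simp add: add_divide_distrib sum_divide_distrib card_bitstrings)
  also have "(\<Sum>w\<in>E. (\<Sum>y\<in>?R. weight (\<sigma>((j, x) \<mapsto> y)) j w) / card ?R) = (\<Sum>w\<in>E. weight \<sigma> j w)"
    by (intro sum.cong refl weight_step assms)
  also have "\<dots> = (\<Sum>w\<in>E - listed \<sigma> j. weight \<sigma> j w) + (\<Sum>w\<in>listed \<sigma> j. weight \<sigma> j w)"
    by (rule sum.subset_diff[OF sub finE])
  finally have avg: "(\<Sum>y\<in>?R. potential (\<sigma>((j, x) \<mapsto> y)) j) / card ?R =
    (real L + 1 - card E) * \<theta> +
      ((\<Sum>w\<in>E - listed \<sigma> j. weight \<sigma> j w) + (\<Sum>w\<in>listed \<sigma> j. weight \<sigma> j w))" .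
  have "(\<Sum>w\<in>E - listed \<sigma> j. weight \<sigma> j w) \<le> real (card (E - listed \<sigma> j)) * \<theta>"
    by (rule sum_bounded_above, rule weight_unlisted) (auto simp: E_def listed_def)
  also have "real (card (E - listed \<sigma> j)) = real (card E) - real (card (listed \<sigma> j))"
    using sub finE by (simp add: card_Diff_subset card_mono of_nat_diff)
  finally show ?thesis
    unfolding avg by (simp add: potential_def ring_distribs)
qed

text \<open>Only the factor of the queried oracle moves; the others act as a constant, nonnegative
  since at most \<open>L\<close> words are listed.\<close>

lemma prod_potential_step:
  assumes "dom \<sigma> \<subseteq> {1..t} \<times> \<Sigma>" "card (dom \<sigma>) < Q" "p \<in> {1..t} \<times> \<Sigma>" "\<sigma> p = None"
  shows "(\<Sum>y\<in>bitstrings n. \<Prod>j\<in>{1..t}. potential (\<sigma>(p \<mapsto> y)) j) / card (bitstrings n)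
    \<le> (\<Prod>j\<in>{1..t}. potential \<sigma> j)"
proof -
  obtain j x where p: "p = (j, x)" and j: "j \<in> {1..t}" and x: "x \<in> \<Sigma>" using assms(3) by auto
  let ?r = "\<Prod>j'\<in>{1..t} - {j}. potential \<sigma> j'"
  have "(\<Prod>j'\<in>{1..t}. potential (\<sigma>(p \<mapsto> y)) j') = potential (\<sigma>((j, x) \<mapsto> y)) j * ?r" for y
    by (subst prod.remove[of _ j]) (use j in \<open>auto simp: p potential_upd_other intro!: prod.cong\<close>)
  then have "(\<Sum>y\<in>bitstrings n. \<Prod>j\<in>{1..t}. potential (\<sigma>(p \<mapsto> y)) j) / card (bitstrings n) =
    ((\<Sum>y\<in>bitstrings n. potential (\<sigma>((j, x) \<mapsto> y)) j) / card (bitstrings n)) * ?r"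
    by (simp add: sum_distrib_right)
  also have "\<dots> \<le> potential \<sigma> j * ?r"
    using assms p x by (intro mult_right_mono potential_step prod_nonneg potential_nonneg) auto
  also have "\<dots> = (\<Prod>j\<in>{1..t}. potential \<sigma> j)"
    using j by (intro prod.remove[symmetric]) auto
  finally show ?thesis .
qed

section \<open>From the potential to the success probability for one key\<close>

lemma weight_le_potential:
  assumes "dom \<sigma> \<subseteq> {1..t} \<times> \<Sigma>" "card (dom \<sigma>) \<le> Q" "w \<in> C"
  shows "weight \<sigma> j w \<le> potential \<sigma> j"
proof -
  have L: "real (card (listed \<sigma> j)) \<le> real L" using card_listed_le[OF assms(1,2)] by simp
  show ?thesis
  proof (cases "w \<in> listed \<sigma> j")
    case True
    then have "weight \<sigma> j w \<le> (\<Sum>w\<in>listed \<sigma> j. weight \<sigma> j w)"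
      by (intro member_le_sum) auto
    moreover have "0 \<le> (real L + 1 - card (listed \<sigma> j)) * \<theta>" using L by simp
    ultimately show ?thesis by (simp add: potential_def)
  next
    case False
    \<comment> \<open>The \<open>+ 1\<close> in the budget leaves one \<open>\<theta>\<close> even
      when \<open>L\<close> words are listed; it pays for an unlisted output.\<close>
    have "1 * \<theta> \<le> (real L + 1 - card (listed \<sigma> j)) * \<theta>"
      using L by (intro mult_right_mono) auto
    moreover have "0 \<le> (\<Sum>w\<in>listed \<sigma> j. weight \<sigma> j w)" by (simp add: sum_nonneg)
    ultimately show ?thesis
      using weight_unlisted[OF assms(3) False] by (simp add: potential_def)
  qed
qed

text \<open>The conditions at different points \<open>(j, x)\<close> concern different answers, so
  the passing oracles form a product set and their fraction factors over oracles and
  symbols.\<close>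

lemma passing_fraction:
  assumes "\<And>j. j \<in> {1..t} \<Longrightarrow> \<pi> j \<in> C"
  shows "card {H \<in> oracles ({1..t} \<times> \<Sigma>) (bitstrings n) \<sigma>.
      \<forall>j\<in>{1..t}. \<forall>i\<in>{1..n}. H (j, \<pi> j i) i \<noteq> mask (\<pi> j i) i} /
    card (oracles ({1..t} \<times> \<Sigma>) (bitstrings n) \<sigma>) = (\<Prod>j\<in>{1..t}. weight \<sigma> j (\<pi> j))"
proof -
  let ?A = "answers (bitstrings n) \<sigma>"
  have mem: "\<pi> j i \<in> \<Sigma>" if "j \<in> {1..t}" "i \<in> {1..n}" for j i
    using assms[OF that(1)] code_subset that(2) by fastforce
  have "{H \<in> oracles ({1..t} \<times> \<Sigma>) (bitstrings n) \<sigma>.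
      \<forall>j\<in>{1..t}. \<forall>i\<in>{1..n}. H (j, \<pi> j i) i \<noteq> mask (\<pi> j i) i} =
    PiE ({1..t} \<times> \<Sigma>) (\<lambda>p. {y \<in> ?A p. passes (\<pi> (fst p)) (snd p) y})"
  proof (intro Set.set_eqI, unfold mem_Collect_eq)
    fix H :: "nat \<times> 's \<Rightarrow> nat \<Rightarrow> bool"
    have "(\<forall>p\<in>{1..t} \<times> \<Sigma>. passes (\<pi> (fst p)) (snd p) (H p)) \<longleftrightarrow>
        (\<forall>j\<in>{1..t}. \<forall>i\<in>{1..n}. H (j, \<pi> j i) i \<noteq> mask (\<pi> j i) i)"
      using mem unfolding passes_def by force
    then show "H \<in> oracles ({1..t} \<times> \<Sigma>) (bitstrings n) \<sigma> \<and>
        (\<forall>j\<in>{1..t}. \<forall>i\<in>{1..n}. H (j, \<pi> j i) i \<noteq> mask (\<pi> j i) i) \<longleftrightarrow>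
        H \<in> PiE ({1..t} \<times> \<Sigma>) (\<lambda>p. {y \<in> ?A p. passes (\<pi> (fst p)) (snd p) y})"
      unfolding oracles_def PiE_iff by blast
  qed
  then show ?thesis
    by (simp add: oracles_def card_PiE weight_def pass_prob_def prod.cartesian_product
        prod_dividef split_def)
qed

text \<open>Restricting to outputs with key \<open>K\<close> fixes the mask in advance, although the
  adversary may choose its key after querying. The bound is the initial potential.\<close>

lemma success_le:
  fixes A :: "(nat \<times> 's, nat \<Rightarrow> bool, 'k \<times> (nat \<Rightarrow> nat \<Rightarrow> 's)) adversary"
  assumes "\<And>H. H \<in> ({1..t} \<times> \<Sigma>) \<rightarrow>\<^sub>E bitstrings n \<Longrightarrow> queries_at_most ({1..t} \<times> \<Sigma>) H A Q"
    and f: "f K = mask" and "0 < n" "\<zeta> < 1"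
  shows "success_prob ({1..t} \<times> \<Sigma>) (bitstrings n)
      (\<lambda>H z. fst z = K \<and> verify_tilde \<Sigma> n C t \<K> f H z) A \<le> ((real L + 1) * \<theta>) ^ t"
proof -
  let ?V = "\<lambda>H z. fst z = K \<and> verify_tilde \<Sigma> n C t \<K> f H z"
  let ?O = "oracles ({1..t} \<times> \<Sigma>) (bitstrings n)"
  have final: "card {H \<in> ?O \<sigma>. ?V H z} / card (?O \<sigma>) \<le> (\<Prod>j\<in>{1..t}. potential \<sigma> j)"
    if \<sigma>: "dom \<sigma> \<subseteq> {1..t} \<times> \<Sigma>" "card (dom \<sigma>) \<le> Q" for \<sigma> z
  proof (cases "\<forall>j\<in>{1..t}. snd z j \<in> C")
    case True
    have "card {H \<in> ?O \<sigma>. ?V H z} \<le> card {H \<in> ?O \<sigma>.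
        \<forall>j\<in>{1..t}. \<forall>i\<in>{1..n}. H (j, snd z j i) i \<noteq> mask (snd z j i) i}"
      by (rule card_mono)
        (auto simp: verify_tilde_def verify_def masked_oracle_def xor_bits_def f[symmetric] case_prod_unfold)
    then have "card {H \<in> ?O \<sigma>. ?V H z} / card (?O \<sigma>) \<le> (\<Prod>j\<in>{1..t}. weight \<sigma> j (snd z j))"
      using True by (subst passing_fraction[symmetric]) (auto intro!: divide_right_mono)
    also have "\<dots> \<le> (\<Prod>j\<in>{1..t}. potential \<sigma> j)"
      using True by (intro prod_mono) (auto intro!: weight_le_potential \<sigma>)
    finally show ?thesis .
  next
    case False
    \<comment> \<open>A tuple with a component outside the code is never accepted, so nonnegativity
      of the potential suffices.\<close>
    then have "{H \<in> ?O \<sigma>. ?V H z} = {}"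
      by (auto simp: verify_tilde_def verify_def case_prod_unfold)
    then show ?thesis
      by (simp add: prod_nonneg potential_nonneg[OF \<sigma>] del: Collect_empty_eq)
  qed
  have "success_prob ({1..t} \<times> \<Sigma>) (bitstrings n) ?V A \<le> (\<Prod>j\<in>{1..t}. potential Map.empty j)"
    unfolding success_prob_def oracles_empty[symmetric]
    by (rule success_le_potential[where Q = Q and b = Q, OF prod_potential_step final])
      (use assms(1) in auto)
  \<comment> \<open>Before any query the agreement count is 0, below the positive threshold
    \<open>(1 - \<zeta>) * real n\<close>, so each factor is the full budget.\<close>
  also have "listed Map.empty j = {}" for j
    using \<open>0 < n\<close> \<open>\<zeta> < 1\<close> by (auto simp: listed_def queried_def not_le)
  then have "(\<Prod>j\<in>{1..t}. potential Map.empty j) = ((real L + 1) * \<theta>) ^ t"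
    by (simp add: potential_def)
  finally show ?thesis .
qed

end

section \<open>All keys, asymptotically\<close>

text \<open>A smaller \<open>\<zeta>'\<close> demands agreement in more coordinates, so fewer words
  qualify. This lets a varying \<open>\<zeta>\<close> be replaced by a constant.\<close>

lemma list_recoverable_antimono:
  assumes "list_recoverable C \<Sigma> n \<zeta> l L" "\<zeta>' \<le> \<zeta>" "finite C"
  shows "list_recoverable C \<Sigma> n \<zeta>' l L"
  unfolding list_recoverable_def
proof (intro allI impI)
  fix S assume S: "\<forall>i\<in>{1..n}. S i \<subseteq> \<Sigma> \<and> real (card (S i)) \<le> l"
  have "(1 - \<zeta>) * real n \<le> (1 - \<zeta>') * real n"
    using assms(2) by (intro mult_right_mono) auto
  then have "card {x \<in> C. (1 - \<zeta>') * real n \<le> card {i \<in> {1..n}. x i \<in> S i}} \<le>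
      card {x \<in> C. (1 - \<zeta>) * real n \<le> card {i \<in> {1..n}. x i \<in> S i}}"
    using assms(3) by (intro card_mono) auto
  moreover have "real (card {x \<in> C. (1 - \<zeta>) * real n \<le> card {i \<in> {1..n}. x i \<in> S i}}) \<le> L"
    using assms(1) S unfolding list_recoverable_def by blast
  ultimately show "real (card {x \<in> C. (1 - \<zeta>') * real n \<le> card {i \<in> {1..n}. x i \<in> S i}}) \<le> L"
    by linarith
qed

text \<open>Union bound over the key in the output: each key gives a game with a fixed mask, and the
  bound on the game is the same for all masks.\<close>

lemma crom_sound_verify_tilde:
  fixes l :: real
  assumes "finite \<Sigma>" "C \<subseteq> {1..n} \<rightarrow>\<^sub>E \<Sigma>"
    and rec: "list_recoverable C \<Sigma> n \<zeta> l (real L)" and "0 \<le> l" "\<zeta> < 1" "0 < n"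
    and "finite \<K>"
  shows "crom_sound ({1..t} \<times> \<Sigma>) (bitstrings n) (verify_tilde \<Sigma> n C t \<K> f) l
    (real (card \<K>) * ((real L + 1) * 2 powr (- \<zeta> * real n)) ^ t)"
  unfolding crom_sound_def
proof (intro allI impI)
  fix A :: "(nat \<times> 'a, nat \<Rightarrow> bool, 'b \<times> (nat \<Rightarrow> nat \<Rightarrow> 'a)) adversary"
  let ?D = "{1..t} \<times> \<Sigma>"
  assume A: "\<forall>H\<in>?D \<rightarrow>\<^sub>E bitstrings n. queries_at_most ?D H A (nat \<lfloor>l\<rfloor>)"
  have game: "code_game \<Sigma> n L (nat \<lfloor>l\<rfloor>) C \<zeta>"
  proof
    fix S assume S: "S \<subseteq> \<Sigma>" "card S \<le> nat \<lfloor>l\<rfloor>"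
    then have "real (card S) \<le> l"
      using \<open>0 \<le> l\<close> by linarith
    then show "card {w \<in> C. (1 - \<zeta>) * real n \<le> real (card {i \<in> {1..n}. w i \<in> S})} \<le> L"
      using rec[unfolded list_recoverable_def, rule_format, of "\<lambda>_. S"] S by simp
  qed (use assms in auto)
  have "success_prob ?D (bitstrings n) (verify_tilde \<Sigma> n C t \<K> f) A \<le>
    (\<Sum>K\<in>\<K>. success_prob ?D (bitstrings n) (\<lambda>H z. fst z = K \<and> verify_tilde \<Sigma> n C t \<K> f H z) A)"
    using \<open>finite \<K>\<close> by (rule success_prob_union_bound) (auto simp: verify_tilde_def)
  also have "\<dots> \<le> (\<Sum>K\<in>\<K>. ((real L + 1) * 2 powr (- \<zeta> * real n)) ^ t)"
  proof (rule sum_mono)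
    fix K
    show "success_prob ?D (bitstrings n) (\<lambda>H z. fst z = K \<and> verify_tilde \<Sigma> n C t \<K> f H z) A \<le>
        ((real L + 1) * 2 powr (- \<zeta> * real n)) ^ t"
      using code_game.success_le[OF game, where mask = "f K" and t = t and K = K and f = f and A = A] A
        \<open>0 < n\<close> \<open>\<zeta> < 1\<close>
      unfolding code_game.\<theta>_def[OF game] by blast
  qed
  finally show "success_prob ?D (bitstrings n) (verify_tilde \<Sigma> n C t \<K> f) A \<le>
      real (card \<K>) * ((real L + 1) * 2 powr (- \<zeta> * real n)) ^ t"
    by simp
qed

lemma crom_sound_mono:
  "crom_sound D R V Q \<epsilon> \<Longrightarrow> \<epsilon> \<le> \<epsilon>' \<Longrightarrow> crom_sound D R V Q \<epsilon>'"
  unfolding crom_sound_def by (meson order_trans)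

section \<open>Asymptotics in the security parameter\<close>

lemma bigomega_eventually_ge:
  assumes "f \<in> \<Omega>(g)" "eventually (\<lambda>x. 0 \<le> f x) at_top" "eventually (\<lambda>x. 0 \<le> g x) at_top"
  obtains a :: real where "a > 0" "\<forall>\<^sub>F x in at_top. a * g x \<le> (f x :: real)"
proof -
  obtain a where "a > 0" and a: "\<forall>\<^sub>F x in at_top. norm (f x) \<ge> a * norm (g x)"
    using assms(1) by (elim landau_omega.bigE)
  have "\<forall>\<^sub>F x in at_top. a * g x \<le> f x"
    using a assms(2,3) by eventually_elim simp
  with \<open>a > 0\<close> show ?thesis using that by blast
qed

text \<open>The polylogarithmic factor hidden in a soft-O bound does not make up for an exponent
  below 1.\<close>

lemma powr_times_ln_power_smallo:
  assumes "c < 1"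
  shows "(\<lambda>\<kappa>. real \<kappa> powr c * ln (real \<kappa>) ^ d) \<in> o(\<lambda>\<kappa>. real \<kappa>)"
  using assms by real_asymp

text \<open>The exponent \<open>z * a * k\<close> is split: one half absorbs \<open>L + 1\<close>,
  the other half remains as the bound.\<close>

lemma list_size_times_powr_le:
  fixes L :: nat and z a k n :: real
  assumes "a * k \<le> n" "1 + log 2 L \<le> z * a / 2 * k" "0 \<le> z"
  shows "(real L + 1) * 2 powr (- z * n) \<le> 2 powr (- (z * a / 2) * k)"
proof -
  have "real L + 1 \<le> 2 powr (1 + log 2 L)"
    \<comment> \<open>for \<open>L = 0\<close>, \<open>log 2 0 = 0\<close> by convention\<close>
    by (cases "L = 0") (simp_all add: powr_add log_def[of 2 0])
  also have "\<dots> \<le> 2 powr (z * a / 2 * k)" using assms(2) by simp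
  finally have "(real L + 1) * 2 powr (- z * n) \<le> 2 powr (z * a / 2 * k) * 2 powr (- z * n)"
    by (intro mult_right_mono) auto
  also have "\<dots> = 2 powr (z * a / 2 * k - z * n)" by (simp flip: powr_add)
  also have "\<dots> \<le> 2 powr (- (z * a / 2) * k)"
    using mult_left_mono[OF assms(1,3)] by (simp add: algebra_simps)
  finally show ?thesis .
qed

theorem lemma6p11:
  fixes c c' :: real
    and F :: "nat \<Rightarrow> ('a, 'b) ring_scheme"
    and m n L :: "nat \<Rightarrow> nat"
    and \<zeta> :: "nat \<Rightarrow> real"
    and C :: "nat \<Rightarrow> (nat \<Rightarrow> nat \<Rightarrow> 'a) set"
  assumes exponents: "0 < c" "c < c'" "c' < 1"
    and finite_field: "\<And>\<kappa>. 1 \<le> \<kappa> \<Longrightarrow> Ring.field (F \<kappa>) \<and> finite (carrier (F \<kappa>))"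
    and linear_code: "\<And>\<kappa>. 1 \<le> \<kappa> \<Longrightarrow> submodule (C \<kappa>) (F \<kappa>) (word_space (F \<kappa>) (m \<kappa>) (n \<kappa>))"
    and alphabet_size: "\<exists>a b. 0 < a \<and> 0 < b \<and> (\<forall>\<^sub>F \<kappa> in sequentially.
          2 powr (real \<kappa> powr a) \<le> real (card (alphabet (F \<kappa>) (m \<kappa>))) \<and>
          real (card (alphabet (F \<kappa>) (m \<kappa>))) \<le> 2 powr (real \<kappa> powr b))"
    and code_length: "(\<lambda>\<kappa>. real (n \<kappa>)) \<in> \<Theta>(\<lambda>\<kappa>. real \<kappa>)"
    and code_size: "\<And>\<kappa>. 1 \<le> \<kappa> \<Longrightarrow> 2 ^ (n \<kappa> + \<kappa>) \<le> card (C \<kappa>)"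
    and list_rec: "\<And>\<kappa>. 1 \<le> \<kappa> \<Longrightarrow>
          list_recoverable (C \<kappa>) (alphabet (F \<kappa>) (m \<kappa>)) (n \<kappa>)
            (\<zeta> \<kappa>) (2 powr (real \<kappa> powr c)) (real (L \<kappa>))"
    and zeta: "\<And>\<kappa>. 1 \<le> \<kappa> \<Longrightarrow> 0 < \<zeta> \<kappa>" "\<zeta> \<in> \<Omega>(\<lambda>_. 1)"
    and list_size: "\<exists>d::nat. (\<lambda>\<kappa>. log 2 (real (L \<kappa>))) \<in>
          O(\<lambda>\<kappa>. real \<kappa> powr c' * ln (real \<kappa>) ^ d)"
  shows "\<exists>\<delta>>0. \<forall>\<^sub>F \<kappa> in sequentially. \<forall>t\<ge>1. \<forall>(\<K> :: 'k set) f.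
    kwise_independent_hash (2 * (\<kappa> * n \<kappa> + 1)) \<K> f
      (alphabet (F \<kappa>) (m \<kappa>)) (bitstrings (n \<kappa>)) \<longrightarrow>
    crom_sound ({1..t} \<times> alphabet (F \<kappa>) (m \<kappa>)) (bitstrings (n \<kappa>))
      (verify_tilde (alphabet (F \<kappa>) (m \<kappa>)) (n \<kappa>) (C \<kappa>) t \<K> f)
      (2 powr (real \<kappa> powr c))
      (real (card \<K>) * 2 powr (- \<delta> * real t * real \<kappa>))"
proof -
  have pos: "\<forall>\<^sub>F \<kappa> in sequentially. 1 \<le> \<kappa>" by (rule eventually_ge_at_top)
  obtain a where a: "0 < a" "\<forall>\<^sub>F \<kappa> in sequentially. a * real \<kappa> \<le> real (n \<kappa>)"
    using bigthetaD2[OF code_length] by (rule bigomega_eventually_ge) auto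
  have "\<forall>\<^sub>F \<kappa> in sequentially. 0 \<le> \<zeta> \<kappa>"
    using pos by eventually_elim (simp add: zeta(1) less_imp_le)
  then obtain z0 where z0: "0 < z0" "\<forall>\<^sub>F \<kappa> in sequentially. z0 * 1 \<le> \<zeta> \<kappa>"
    using bigomega_eventually_ge[OF zeta(2)] by auto
  \<comment> \<open>Capping at 1/2 secures \<open>z < 1\<close>, which makes the initial list empty;
    lowering \<open>\<zeta>\<close> keeps list recoverability.\<close>
  define z where "z = min z0 (1/2)"
  have z: "0 < z" "z < 1" "z \<le> z0" using z0(1) by (auto simp: z_def)
  \<comment> \<open>Half of the rate \<open>z * a\<close>; the other half is spent on the list
    size.\<close>
  define \<delta> where "\<delta> = z * a / 2"
  have "0 < \<delta>" using a z by (simp add: \<delta>_def)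
  obtain d :: nat where "(\<lambda>\<kappa>. log 2 (real (L \<kappa>))) \<in> O(\<lambda>\<kappa>. real \<kappa> powr c' * ln (real \<kappa>) ^ d)"
    using list_size by blast
  then have "(\<lambda>\<kappa>. log 2 (real (L \<kappa>))) \<in> o(\<lambda>\<kappa>. real \<kappa>)"
    using powr_times_ln_power_smallo[OF exponents(3)] by (rule landau_o.big_small_trans)
  moreover have "(\<lambda>\<kappa>. 1) \<in> o(\<lambda>\<kappa>. real \<kappa>)" by real_asymp
  \<comment> \<open>The summand 1 comes from bounding \<open>L + 1\<close> by
    \<open>2 powr (1 + log 2 L)\<close>.\<close>
  ultimately have "(\<lambda>\<kappa>. 1 + log 2 (real (L \<kappa>))) \<in> o(\<lambda>\<kappa>. real \<kappa>)"
    by (intro sum_in_smallo)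
  from landau_o.smallD[OF this \<open>0 < \<delta>\<close>]
  have L: "\<forall>\<^sub>F \<kappa> in sequentially. 1 + log 2 (real (L \<kappa>)) \<le> \<delta> * real \<kappa>"
    by eventually_elim simp
  have "\<forall>\<^sub>F \<kappa> in sequentially. \<forall>t\<ge>1. \<forall>(\<K> :: 'k set) f.
    kwise_independent_hash (2 * (\<kappa> * n \<kappa> + 1)) \<K> f
      (alphabet (F \<kappa>) (m \<kappa>)) (bitstrings (n \<kappa>)) \<longrightarrow>
    crom_sound ({1..t} \<times> alphabet (F \<kappa>) (m \<kappa>)) (bitstrings (n \<kappa>))
      (verify_tilde (alphabet (F \<kappa>) (m \<kappa>)) (n \<kappa>) (C \<kappa>) t \<K> f)
      (2 powr (real \<kappa> powr c))
      (real (card \<K>) * 2 powr (- \<delta> * real t * real \<kappa>))"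
    \<comment> \<open>All eventual conditions concern \<open>\<kappa>\<close> alone, so neither the
      threshold nor \<open>\<delta>\<close> depends on \<open>t\<close>, the keys or the hash
      family.\<close>
    using pos a(2) z0(2) L
  proof eventually_elim
    case (elim \<kappa>)
    let ?\<Sigma> = "alphabet (F \<kappa>) (m \<kappa>)"
    have fin: "finite ?\<Sigma>"
      using finite_field[OF elim(1)] by (simp add: alphabet_def finite_PiE)
    have sub: "C \<kappa> \<subseteq> {1..n \<kappa>} \<rightarrow>\<^sub>E ?\<Sigma>"
      using module.submoduleE(1)[OF word_space_module linear_code[OF elim(1)]] finite_field[OF elim(1)]
      by (simp add: word_space_def)
    have "0 < a * real \<kappa>" using a(1) elim(1) by simp
    then have "0 < n \<kappa>" using elim(2) by linarith
    have rec: "list_recoverable (C \<kappa>) ?\<Sigma> (n \<kappa>) z (2 powr (real \<kappa> powr c)) (real (L \<kappa>))"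
      using list_rec[OF elim(1)] by (rule list_recoverable_antimono)
        (use elim(3) z(3) finite_subset[OF sub] fin in \<open>simp_all add: finite_PiE\<close>)
    have base: "(real (L \<kappa>) + 1) * 2 powr (- z * real (n \<kappa>)) \<le> 2 powr (- \<delta> * real \<kappa>)"
      using list_size_times_powr_le[OF elim(2), of "L \<kappa>" z] elim(4) z(1) by (simp add: \<delta>_def)
    show ?case
    proof (intro allI impI)
      fix t :: nat and \<K> :: "'k set" and f
      assume "kwise_independent_hash (2 * (\<kappa> * n \<kappa> + 1)) \<K> f ?\<Sigma> (bitstrings (n \<kappa>))"
      then have "finite \<K>" by (simp add: kwise_independent_hash_def)
      have "((real (L \<kappa>) + 1) * 2 powr (- z * real (n \<kappa>))) ^ t \<le> (2 powr (- \<delta> * real \<kappa>)) ^ t"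
        using base by (rule power_mono) simp
      also have "\<dots> = 2 powr (- \<delta> * real t * real \<kappa>)"
        by (simp add: powr_power mult_ac)
      finally show "crom_sound ({1..t} \<times> ?\<Sigma>) (bitstrings (n \<kappa>))
          (verify_tilde ?\<Sigma> (n \<kappa>) (C \<kappa>) t \<K> f) (2 powr (real \<kappa> powr c))
          (real (card \<K>) * 2 powr (- \<delta> * real t * real \<kappa>))"
        by (intro crom_sound_mono[OF crom_sound_verify_tilde[OF fin sub rec _ z(2) \<open>0 < n \<kappa>\<close> \<open>finite \<K>\<close>]]
            mult_left_mono) auto
    qed
  qed
  with \<open>0 < \<delta>\<close> show ?thesis by blast
qed

end
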